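(* Let $f \in \mathbb{R}[X,Y]$ with $f > 0$ on $[0,1]\times \mathbb{R}$, let $m = \deg_Y f$, suppose $f$ is fully $m$-ic on $[0,1]$ and $d = \deg_X f \ge 2$, and let $$f^{\bullet} = \min\{\bar f(x,y,z) \mid x \in [0,1],\ y^2+z^2 = 1\} > 0.$$ Then there exist $\sigma_0, \sigma_1 \in \sum \mathbb{R}[X,Y]^2$ such that $f = \sigma_0 + \sigma_1 X(1-X)$ and $$\deg(\sigma_0) \le \frac{d^3(m+1)\|f\|_{\infty}}{f^{\bullet}}, \qquad \deg(\sigma_1 X(1-X)) \le \frac{d^3(m+1)\|f\|_{\infty}}{f^{\bullet}}.$$
   Context: $\sum \mathbb{R}[X,Y]^2$ denotes the set of finite sums of squares of polynomials in $\mathbb{R}[X,Y]$; $\deg$ denotes total degree, and $\deg_X$, $\deg_Y$ denote the degrees in $X$ and $Y$. For $f \in \mathbb{R}[X,Y]$ with $m = \deg_Y f$, $f$ is fully $m$-ic on $[0,1]$ if for every $x \in [0,1]$ the polynomial $f(x,Y) \in \mathbb{R}[Y]$ has degree $m$. With $m = \deg_Y f$, $d = \deg_X f$, write $f = \sum_{0 \le i \le m}\sum_{0 \le j \le d} a_{ji}X^jY^i$. Define $$\bar f = \sum_{0 \le i \le m}\sum_{0 \le j \le d} a_{ji}X^jY^iZ^{m-i} \in \mathbb{R}[X,Y,Z], \qquad \|f\|_{\infty} = \max\{|a_{ji}| \mid 0 \le i \le m,\ 0 \le j \le d\}.$$ (Under the hypotheses of the claim, $\bar f > 0$ on $\{(x,y,z)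 \mid x\in[0,1],\ y^2+z^2=1\}$.) *)

theory Defs
  imports "HOL-Analysis.Analysis" "HOL-Computational_Algebra.Polynomial"
begin

text \<open>
  \<open>\<real>[X,Y]\<close> is represented as \<open>\<real>[X][Y]\<close>, the type \<^typ>\<open>real poly poly\<close>: the outer variable is
  \<open>Y\<close>, and \<open>coeff (coeff f i) j\<close> is the coefficient of \<open>X\<^sup>j Y\<^sup>i\<close>.  Likewise \<open>\<real>[X,Y,Z]\<close> is
  \<open>\<real>[X][Y][Z]\<close>, with outermost variable \<open>Z\<close>.
\<close>

abbreviation (input) var_X :: "real poly poly"
  where "var_X \<equiv> [:[:0, 1:]:]"

definition eval2 :: "real poly poly \<Rightarrow> real \<Rightarrow> real \<Rightarrow> real"
  where "eval2 f x y = poly (poly f [:y:]) x"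

definition eval3 :: "real poly poly poly \<Rightarrow> real \<Rightarrow> real \<Rightarrow> real \<Rightarrow> real"
  where "eval3 F x y z = poly (poly (poly F [:[:z:]:]) [:y:]) x"

text \<open>All degrees of the zero polynomial are \<open>0\<close>, as for \<^const>\<open>degree\<close>.\<close>

definition deg_Y :: "real poly poly \<Rightarrow> nat"
  where "deg_Y f = degree f"

definition deg_X :: "real poly poly \<Rightarrow> nat"
  where "deg_X f = (MAX i\<in>{..degree f}. degree (coeff f i))"

definition total_deg :: "real poly poly \<Rightarrow> nat"
  where "total_deg f = Max (insert 0 {i + j | i j. coeff (coeff f i) j \<noteq> 0})"

definition sums_of_squares :: "'a::comm_semiring_1 set"
  where "sums_of_squares = {\<Sum>k<n. (g k)\<^sup>2 | (n::nat) g. True}"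

text \<open>The polynomial \<open>f(x,Y) \<in> \<real>[Y]\<close>.\<close>

definition spec_X :: "real poly poly \<Rightarrow> real \<Rightarrow> real poly"
  where "spec_X f x = map_poly (\<lambda>c. poly c x) f"

definition fully_mic :: "nat \<Rightarrow> real poly poly \<Rightarrow> bool"
  where "fully_mic m f \<longleftrightarrow> deg_Y f = m \<and> (\<forall>x\<in>{0..1}. degree (spec_X f x) = m)"

definition homog_Y :: "real poly poly \<Rightarrow> real poly poly poly"
  where "homog_Y f =
    (\<Sum>i\<le>deg_Y f. \<Sum>j\<le>deg_X f.
       monom (monom (monom (coeff (coeff f i) j) j) i) (deg_Y f - i))"

definition norm_inf :: "real poly poly \<Rightarrow> real"
  where "norm_inf f = Max {\<bar>coeff (coeff f i) j\<bar> | i j. i \<le> deg_Y f \<and> j \<le> deg_X f}"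

definition cylinder_values :: "real poly poly \<Rightarrow> real set"
  where "cylinder_values f =
    {eval3 (homog_Y f) x y z | x y z. x \<in> {0..1} \<and> y\<^sup>2 + z\<^sup>2 = 1}"

text \<open>
  The minimum is written with \<open>LEAST\<close> because \<^const>\<open>Min\<close> is only meaningful on finite sets; by
  \<open>f_bullet_in\<close> and \<open>f_bullet_le\<close> below it is always attained.
\<close>

definition f_bullet :: "real poly poly \<Rightarrow> real"
  where "f_bullet f = (LEAST v. v \<in> cylinder_values f)"

lemma finite_support:
  fixes f :: "real poly poly"
  shows "finite {i + j | i j. coeff (coeff f i) j \<noteq> 0}"
proof (rule finite_subset)
  show "{i + j | i j. coeff (coeff f i) j \<noteq> 0}
      \<subseteq> (\<Union>i\<in>{..degree f}. (\<lambda>j. i + j) ` {..degree (coeff f i)})"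
  proof
    fix k assume "k \<in> {i + j | i j. coeff (coeff f i) j \<noteq> 0}"
    then obtain i j where k: "k = i + j" "coeff (coeff f i) j \<noteq> 0" by blast
    then have "i \<le> degree f" "j \<le> degree (coeff f i)"
      by (auto intro: le_degree)
    with k show "k \<in> (\<Union>i\<in>{..degree f}. (\<lambda>j. i + j) ` {..degree (coeff f i)})"
      by blast
  qed
qed auto

lemma eval3_homog_Y:
  "eval3 (homog_Y f) x y z =
    (\<Sum>i\<le>deg_Y f. \<Sum>j\<le>deg_X f. coeff (coeff f i) j * x ^ j * y ^ i * z ^ (deg_Y f - i))"
  by (simp add: eval3_def homog_Y_def poly_sum poly_monom poly_mult poly_power mult_ac)

lemma cylinder_values_min:
  "\<exists>v \<in> cylinder_values f. \<forall>w \<in> cylinder_values f. v \<le> w"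
proof -
  define K where "K = {0..1::real} \<times> sphere (0::real \<times> real) 1"
  define F where "F = (\<lambda>p. eval3 (homog_Y f) (fst p) (fst (snd p)) (snd (snd p)))"
  have "compact K" unfolding K_def by (intro compact_Times compact_Icc compact_sphere)
  moreover have "((0::real), (0::real, 1::real)) \<in> K"
    by (simp add: K_def norm_Pair)
  moreover have "continuous_on K F"
    unfolding F_def eval3_homog_Y by (intro continuous_intros)
  ultimately obtain p where p: "p \<in> K" "\<forall>q\<in>K. F p \<le> F q"
    using continuous_attains_inf[of K F] by blast
  have K: "(x, y, z) \<in> K \<longleftrightarrow> x \<in> {0..1} \<and> y\<^sup>2 + z\<^sup>2 = 1" for x y z
    by (auto simp: K_def norm_Pair)
  have "cylinder_values f = F ` K"
  proof (intro equalityI subsetI)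
    fix v assume "v \<in> cylinder_values f"
    then obtain x y z where "v = F (x, y, z)" "x \<in> {0..1}" "y\<^sup>2 + z\<^sup>2 = 1"
      by (auto simp: cylinder_values_def F_def)
    then show "v \<in> F ` K" using K by blast
  next
    fix v assume "v \<in> F ` K"
    then obtain x y z where "v = F (x, y, z)" "(x, y, z) \<in> K" by auto
    then show "v \<in> cylinder_values f"
      unfolding K cylinder_values_def F_def by auto
  qed
  with p show ?thesis by auto
qed

lemma f_bullet_in: "f_bullet f \<in> cylinder_values f"
  and f_bullet_le: "w \<in> cylinder_values f \<Longrightarrow> f_bullet f \<le> w"
proof -
  obtain v where v: "v \<in> cylinder_values f" "\<forall>w \<in> cylinder_values f. v \<le> w"
    using cylinder_values_min by blast
  then have "f_bullet f = v"
    unfolding f_bullet_def by (intro Least_equality) auto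
  with v show "f_bullet f \<in> cylinder_values f"
    and "w \<in> cylinder_values f \<Longrightarrow> f_bullet f \<le> w" by auto
qed

end

theory Submission
  imports Defs "HOL-Computational_Algebra.Fundamental_Theorem_Algebra"
begin

text \<open>
  Expand \<open>f\<close> in the Bernstein basis \<open>X\<^sup>k (1 - X)\<^sup>N\<^sup>-\<^sup>k\<close> with coefficients in \<open>\<real>[Y]\<close>.  Up to the factor
  \<open>N choose k\<close>, the \<open>k\<close>-th coefficient arises from \<open>f(k/N, Y)\<close> by replacing each power \<open>(k/N)\<^sup>j\<close>
  with \<open>k(k-1)\<dots>(k-j+1) / N(N-1)\<dots>(N-j+1)\<close>, and these differ by at most \<open>j(j-1)/(2N)\<close>.  After homogenising, the
  perturbation on the circle is at most \<open>(m+1) \<parallel>f\<parallel> (d\<^sup>3 - d)/(6N)\<close>, so for \<open>N\<close> large against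
  \<open>d\<^sup>3 (m+1) \<parallel>f\<parallel> / (6 f\<^sup>\<bullet>)\<close> all coefficients are nonnegative on \<open>\<real>\<close>, hence sums of squares.
  With \<open>N\<close> even, the terms with \<open>k\<close> even go into \<open>\<sigma>0\<close> and those with \<open>k\<close> odd contain the factor
  \<open>X (1 - X)\<close> times a square; both sums have total degree at most \<open>m + N\<close>.  Since
  \<open>\<parallel>f\<parallel> \<ge> f\<^sup>\<bullet>\<close> and \<open>d \<ge> 2\<close>, there is room for \<open>m\<close> and for the rounding of \<open>N\<close>.
\<close>

section \<open>Sums of squares\<close>

lemma sums_of_squares_0: "0 \<in> sums_of_squares"
  unfolding sums_of_squares_def by (auto intro!: exI[of _ 0])

lemma sums_of_squares_add_square:
  assumes "p \<in> sums_of_squares"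
  shows "p + q\<^sup>2 \<in> sums_of_squares"
proof -
  obtain n :: nat and g where p: "p = (\<Sum>k<n. (g k)\<^sup>2)"
    using assms unfolding sums_of_squares_def by blast
  have "p + q\<^sup>2 = (\<Sum>k<Suc n. ((g(n := q)) k)\<^sup>2)"
    by (simp add: p)
  then show ?thesis unfolding sums_of_squares_def by blast
qed

text \<open>This lets closure properties be proved one square at a time, without reindexing or
  concatenating the families \<open>g\<close>.\<close>

lemma sums_of_squares_induct [consumes 1, case_names zero add_square]:
  assumes "p \<in> sums_of_squares" "P 0" "\<And>p q. P p \<Longrightarrow> P (p + q\<^sup>2)"
  shows "P p"
proof -
  obtain n :: nat and g where p: "p = (\<Sum>k<n. (g k)\<^sup>2)"
    using assms(1) unfolding sums_of_squares_def by blast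
  show ?thesis unfolding p by (induction n) (auto intro: assms(2,3))
qed

lemma sums_of_squares_add:
  assumes "p \<in> sums_of_squares" "q \<in> sums_of_squares"
  shows "p + q \<in> sums_of_squares"
  using assms(2,1)
  by (induction rule: sums_of_squares_induct)
     (auto simp: add.assoc[symmetric] intro: sums_of_squares_add_square)

lemma sums_of_squares_mult_square:
  assumes "p \<in> sums_of_squares"
  shows "p * r\<^sup>2 \<in> sums_of_squares"
  using assms
proof (induction rule: sums_of_squares_induct)
  case zero
  then show ?case by (simp add: sums_of_squares_0)
next
  case (add_square p q)
  then show ?case
    using sums_of_squares_add_square[of "p * r\<^sup>2" "q * r"]
    by (simp add: algebra_simps power_mult_distrib)
qed

lemma sums_of_squares_sum:
  "(\<And>i. i \<in> A \<Longrightarrow> p i \<in> sums_of_squares) \<Longrightarrow> (\<Sum>i\<in>A. p i) \<in> sums_of_squares"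
  by (induction A rule: infinite_finite_induct)
     (auto intro: sums_of_squares_0 sums_of_squares_add)

section \<open>Nonnegative univariate polynomials\<close>

text \<open>A nonconstant polynomial is large in absolute value far out, so outside some ball a
  nonnegative one is at least \<open>poly p 0\<close>; the minimum over that compact ball is then
  global.\<close>

lemma nonneg_poly_attains_min:
  fixes p :: "real poly"
  assumes "\<And>x. poly p x \<ge> 0"
  shows "\<exists>r. \<forall>x. poly p r \<le> poly p x"
proof -
  obtain a q where p: "p = pCons a q" by (cases p)
  show ?thesis
  proof (cases "q = 0")
    case True
    then show ?thesis by (simp add: p)
  next
    case False
    obtain R where R: "\<And>x. R \<le> \<bar>x\<bar> \<Longrightarrow> poly p 0 \<le> \<bar>poly p x\<bar>"
      using poly_infinity[OF False, of "poly p 0" a] by (auto simp: p)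
    have "\<exists>r\<in>cball 0 \<bar>R\<bar>. \<forall>x\<in>cball 0 \<bar>R\<bar>. poly p r \<le> poly p x"
      by (intro continuous_attains_inf) (auto intro!: continuous_intros)
    then obtain r where "\<forall>x\<in>cball 0 \<bar>R\<bar>. poly p r \<le> poly p x" by blast
    then have r: "poly p r \<le> poly p x" if "\<bar>x\<bar> \<le> \<bar>R\<bar>" for x using that by simp
    have "poly p r \<le> poly p x" for x
    proof (cases "\<bar>x\<bar> \<le> \<bar>R\<bar>")
      case False
      then have "poly p 0 \<le> poly p x" using R[of x] assms[of x] by auto
      then show ?thesis using r[of 0] by simp
    qed (rule r)
    then show ?thesis by blast
  qed
qed

text \<open>The derivative vanishes at the minimum, so after subtracting the minimum the factor Y -
  r divides twice.\<close>

lemma poly_double_root_at_min: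
  fixes p :: "real poly"
  assumes "\<And>x. poly p r \<le> poly p x"
  obtains q where "p = [:poly p r:] + q * [:-r, 1:]\<^sup>2"
proof -
  have "poly (p - [:poly p r:]) r = 0" by simp
  then obtain s where s: "p - [:poly p r:] = [:-r, 1:] * s"
    by (metis poly_eq_0_iff_dvd dvdE)
  have p: "p = [:poly p r:] + [:-r, 1:] * s" using s by (simp add: algebra_simps)
  have "poly (pderiv p) r = 0"
    by (rule DERIV_local_min[OF poly_DERIV zero_less_one]) (use assms in auto)
  moreover have "pderiv p = [:-r, 1:] * pderiv s + s"
    by (subst p) (simp only: pderiv_add pderiv_mult pderiv_singleton, simp add: pderiv_pCons)
  ultimately have "poly s r = 0" by simp
  then obtain q where "s = [:-r, 1:] * q"
    by (metis poly_eq_0_iff_dvd dvdE)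
  with p have "p = [:poly p r:] + q * [:-r, 1:]\<^sup>2"
    by (simp only: power2_eq_square mult_ac)
  then show ?thesis by (rule that)
qed

text \<open>Cancelling (x - r)^2 from an inequality says nothing at x = r; continuity supplies the
  sign there.\<close>

lemma poly_nonneg_if_nonneg_off_point:
  fixes q :: "real poly"
  assumes "\<And>x. x \<noteq> r \<Longrightarrow> poly q x \<ge> 0"
  shows "poly q x \<ge> 0"
proof (cases "x = r")
  case True
  have "(poly q \<longlongrightarrow> poly q r) (at r)"
    using poly_isCont isCont_def by blast
  moreover have "\<forall>\<^sub>F x in at r. 0 \<le> poly q x"
    unfolding eventually_at_filter using assms by simp
  ultimately show ?thesis
    unfolding True by (rule tendsto_lowerbound) simp
qed (rule assms)

text \<open>Subtracting the minimum, attained at \<open>r\<close>, leaves a nonnegative multiple of \<open>(Y - r)\<^sup>2\<close>.\<close>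

lemma nonneg_poly_sums_of_squares:
  fixes p :: "real poly"
  assumes "\<And>x. poly p x \<ge> 0"
  shows "p \<in> sums_of_squares"
  using assms
proof (induction "degree p" arbitrary: p rule: less_induct)
  case less
  obtain r where r: "\<And>x. poly p r \<le> poly p x"
    using nonneg_poly_attains_min[OF less.prems] by blast
  obtain q where q: "p = [:poly p r:] + q * [:-r, 1:]\<^sup>2"
    using poly_double_root_at_min[OF r] by blast
  define c where "c = poly p r"
  \<comment> \<open>The minimum value is itself nonnegative, hence a square.\<close>
  have c: "[:c:] = [:sqrt c:]\<^sup>2"
    using less.prems[of r] by (simp add: c_def power2_eq_square)
  have pq: "p = q * [:-r, 1:]\<^sup>2 + [:sqrt c:]\<^sup>2"
    using q unfolding c_def[symmetric] c by (simp add: add.commute)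
  have "q \<in> sums_of_squares"
  proof (cases "q = 0")
    case False
    have deg: "degree (q * [:-r, 1:]\<^sup>2) = degree q + 2"
      using False by (simp add: degree_mult_eq degree_power_eq)
    have "degree p = degree q + 2"
      by (subst q, subst degree_add_eq_right) (use deg in auto)
    moreover have "poly q x \<ge> 0" for x
    proof (rule poly_nonneg_if_nonneg_off_point)
      fix x assume "x \<noteq> r"
      moreover have "poly q x * (x - r)\<^sup>2 = poly p x - poly p r"
        by (subst q) (simp add: algebra_simps)
      ultimately show "0 \<le> poly q x"
        using r[of x] by (metis diff_ge_0_iff_ge right_minus_eq zero_le_mult_iff
            zero_less_power2 not_le mult_neg_pos)
    qed
    ultimately show ?thesis by (intro less.hyps) auto
  qed (simp add: sums_of_squares_0)
  then show ?case
    by (subst pq) (intro sums_of_squares_add_square sums_of_squares_mult_square)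
qed

section \<open>Embedding of univariate polynomials in \<open>Y\<close>\<close>

definition poly_in_Y :: "real poly \<Rightarrow> real poly poly"
  where "poly_in_Y p = map_poly (\<lambda>c. [:c:]) p"

lemma coeff_poly_in_Y [simp]: "coeff (poly_in_Y p) i = [:coeff p i:]"
  by (simp add: poly_in_Y_def coeff_map_poly)

lemma poly_in_Y_0 [simp]: "poly_in_Y 0 = 0"
  by (simp add: poly_in_Y_def)

lemma poly_in_Y_add: "poly_in_Y (p + q) = poly_in_Y p + poly_in_Y q"
  by (rule poly_eqI) simp

lemma poly_in_Y_sum: "poly_in_Y (\<Sum>i\<in>A. p i) = (\<Sum>i\<in>A. poly_in_Y (p i))"
  by (induction A rule: infinite_finite_induct) (auto simp: poly_in_Y_add)

lemma sum_const_poly: "(\<Sum>i\<in>A. [:f i:]) = [:\<Sum>i\<in>A. f i:]"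
  by (induction A rule: infinite_finite_induct) auto

lemma poly_in_Y_mult: "poly_in_Y (p * q) = poly_in_Y p * poly_in_Y q"
  by (rule poly_eqI) (simp add: coeff_mult sum_const_poly mult.commute)

lemma poly_in_Y_sums_of_squares:
  assumes "p \<in> sums_of_squares"
  shows "poly_in_Y p \<in> sums_of_squares"
  using assms
  by (induction rule: sums_of_squares_induct)
     (auto simp: sums_of_squares_0 poly_in_Y_add poly_in_Y_mult power2_eq_square
       intro: sums_of_squares_add_square[unfolded power2_eq_square])

section \<open>Total degree\<close>

lemma total_deg_le_iff:
  "total_deg f \<le> n \<longleftrightarrow> (\<forall>i j. coeff (coeff f i) j \<noteq> 0 \<longrightarrow> i + j \<le> n)"
  unfolding total_deg_def using finite_support[of f] by (subst Max_le_iff) auto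

lemma total_deg_sum_le:
  "(\<And>k. k \<in> A \<Longrightarrow> total_deg (f k) \<le> n) \<Longrightarrow> total_deg (\<Sum>k\<in>A. f k) \<le> n"
  unfolding total_deg_le_iff coeff_sum by (metis (mono_tags, lifting) sum.neutral)

text \<open>A nonzero coefficient of the product has a nonzero summand in its double convolution,
  and both factors of that summand obey their degree bounds.\<close>

lemma total_deg_mult_le: "total_deg (f * g) \<le> total_deg f + total_deg g"
  unfolding total_deg_le_iff
proof (intro allI impI)
  fix i j assume "coeff (coeff (f * g) i) j \<noteq> 0"
  then have "(\<Sum>a\<le>i. \<Sum>b\<le>j. coeff (coeff f a) b * coeff (coeff g (i - a)) (j - b)) \<noteq> 0"
    by (simp add: coeff_mult coeff_sum)
  then obtain a where a: "a \<le> i"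
    "(\<Sum>b\<le>j. coeff (coeff f a) b * coeff (coeff g (i - a)) (j - b)) \<noteq> 0"
    by (meson sum.neutral atMost_iff)
  then obtain b where b: "b \<le> j" "coeff (coeff f a) b * coeff (coeff g (i - a)) (j - b) \<noteq> 0"
    by (meson sum.neutral atMost_iff)
  have "a + b \<le> total_deg f" "(i - a) + (j - b) \<le> total_deg g"
    using b(2) total_deg_le_iff[of f "total_deg f"] total_deg_le_iff[of g "total_deg g"]
    by (metis mult_zero_left order_refl, metis mult_zero_right order_refl)
  then show "i + j \<le> total_deg f + total_deg g" using a b by linarith
qed

lemma total_deg_power_le: "total_deg f \<le> n \<Longrightarrow> total_deg (f ^ k) \<le> k * n"
proof (induction k)
  case 0
  have "total_deg 1 \<le> 0" unfolding total_deg_le_iff by (auto simp: coeff_1 split: if_splits)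
  then show ?case by simp
next
  case (Suc k)
  then show ?case using total_deg_mult_le[of f "f ^ k"] by simp
qed

lemma total_deg_poly_in_Y_le: "total_deg (poly_in_Y p) \<le> degree p"
  by (auto simp: total_deg_le_iff coeff_pCons intro: le_degree split: nat.splits if_splits)

lemma total_deg_bernstein_term_le:
  assumes "k \<le> N"
  shows "total_deg (poly_in_Y p * var_X ^ k * (1 - var_X) ^ (N - k)) \<le> degree p + N"
proof -
  have X: "total_deg var_X \<le> 1" "total_deg (1 - var_X) \<le> 1"
    by (auto simp: total_deg_le_iff coeff_pCons coeff_1 split: nat.splits if_splits)
  show ?thesis
    using total_deg_mult_le[of "poly_in_Y p * var_X ^ k" "(1 - var_X) ^ (N - k)"]
      total_deg_mult_le[of "poly_in_Y p" "var_X ^ k"] total_deg_poly_in_Y_le[of p]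
      total_deg_power_le[OF X(1), of k] total_deg_power_le[OF X(2), of "N - k"] assms
    by linarith
qed

section \<open>Bernstein coefficients\<close>

text \<open>For \<open>k < j\<close> truncated subtraction would make the binomial 1, hence the
  explicit zero. The factor \<open>N choose k\<close> is not divided out, so the weights are natural
  numbers and make sense in any ring.\<close>

definition bernstein_weight :: "nat \<Rightarrow> nat \<Rightarrow> nat \<Rightarrow> nat"
  where "bernstein_weight N j k = (if j \<le> k then (N - j) choose (k - j) else 0)"

text \<open>Multiply by 1 = (x + (1 - x))^(N - j) and expand. The general ring allows x to be
  \<open>var_X\<close> itself.\<close>

lemma power_bernstein_expansion:
  fixes x :: "'a::comm_ring_1"
  assumes "j \<le> N"
  shows "x ^ j = (\<Sum>k\<le>N. of_nat (bernstein_weight N j k) * x ^ k * (1 - x) ^ (N - k))"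
proof -
  have "x ^ j = x ^ j * (x + (1 - x)) ^ (N - j)" by simp
  also have "\<dots> = (\<Sum>l\<le>N - j. of_nat ((N - j) choose l) * x ^ (l + j) * (1 - x) ^ (N - (l + j)))"
    by (subst binomial_ring)
       (simp add: sum_distrib_left power_add mult_ac diff_diff_left add.commute)
  also have "\<dots> = (\<Sum>k\<in>{j..N}. of_nat (bernstein_weight N j k) * x ^ k * (1 - x) ^ (N - k))"
    using assms
    by (intro sum.reindex_bij_witness[of _ "\<lambda>k. k - j" "\<lambda>l. l + j"])
       (auto simp: bernstein_weight_def)
  also have "\<dots> = (\<Sum>k\<le>N. of_nat (bernstein_weight N j k) * x ^ k * (1 - x) ^ (N - k))"
    by (rule sum.mono_neutral_left) (auto simp: bernstein_weight_def)
  finally show ?thesis .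
qed

text \<open>By the absorption identity, passing from j to j + 1 multiplies the weight by (k - j) /
  (N - j). For k < j the factor with i = k makes the product zero, as required.\<close>

lemma bernstein_weight_eq_prod:
  assumes "j \<le> N" "k \<le> N"
  shows "real (bernstein_weight N j k) =
    real (N choose k) * (\<Prod>i<j. (real k - real i) / (real N - real i))"
  using assms(1)
proof (induction j)
  case 0
  then show ?case by (simp add: bernstein_weight_def)
next
  case (Suc j)
  have "real (bernstein_weight N (Suc j) k) * (real N - real j)
      = real (bernstein_weight N j k) * (real k - real j)"
  proof (cases "Suc j \<le> k")
    case True
    have "(k - j) * ((N - j) choose (k - j)) = (N - j) * ((N - Suc j) choose (k - Suc j))"
      using binomial_absorption[of "k - Suc j" "N - j"] True by (simp add: Suc_diff_Suc)
    then have "real (k - j) * real ((N - j) choose (k - j))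
        = real (N - j) * real ((N - Suc j) choose (k - Suc j))"
      by (metis of_nat_mult)
    then show ?thesis using True Suc.prems
      by (simp add: bernstein_weight_def of_nat_diff mult.commute)
  next
    case False
    then show ?thesis by (cases "k = j") (auto simp: bernstein_weight_def)
  qed
  then show ?case using Suc by (simp add: field_simps)
qed

text \<open>The product is the probability that \<open>j\<close> draws without replacement from \<open>N\<close> items all hit a
  \<open>k\<close>-subset, the power the same with replacement; \<open>j (j - 1) / (2 N)\<close> bounds the probability of a
  collision.\<close>

lemma falling_quotient_bounds:
  fixes N k j :: nat
  defines "v \<equiv> \<lambda>j. \<Prod>i<j. (real k - real i) / (real N - real i)"
  assumes "j \<le> N" "k \<le> N"
  shows "0 \<le> v j \<and> v j \<le> (real k / real N) ^ j \<and>
    (real k / real N) ^ j - v j \<le> real j * (real j - 1) / (2 * real N)"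
  using assms(2)
proof (induction j)
  case 0
  then show ?case by (simp add: v_def)
next
  case (Suc j)
  define t s where "t = real k / real N" and "s = (real k - real j) / (real N - real j)"
  have t: "0 \<le> t" "t \<le> 1" using assms Suc.prems by (auto simp: t_def)
  have N: "real N > 0" "real N > real j" using Suc.prems by auto
  have v: "v (Suc j) = v j * s" by (simp add: v_def s_def)
  have IH: "0 \<le> v j" "v j \<le> t ^ j" "t ^ j - v j \<le> real j * (real j - 1) / (2 * real N)"
    using Suc unfolding t_def by auto
  have tj: "t ^ j \<le> 1" using t by (simp add: power_le_one)
  \<comment> \<open>For k < j the quotient s is negative, but v j already vanishes. Otherwise t - s
    is j/N times (N - k)/(N - j), which lies in [0, 1].\<close>
  have 1: "0 \<le> v j * s \<and> 0 \<le> v j * (t - s) \<and> v j * (t - s) \<le> real j / real N"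
  proof (cases "k < j")
    case True
    then have "v j = 0" unfolding v_def by (intro prod_zero) auto
    then show ?thesis by simp
  next
    case False
    have ts: "t - s = (real j / real N) * ((real N - real k) / (real N - real j))"
      using N by (simp add: t_def s_def field_simps)
    have b: "0 \<le> (real N - real k) / (real N - real j)" "(real N - real k) / (real N - real j) \<le> 1"
      using N False assms by (auto simp: divide_simps)
    have "0 \<le> s" using False N by (simp add: s_def)
    moreover have "0 \<le> t - s" unfolding ts using b N by (intro mult_nonneg_nonneg) auto
    moreover have "t - s \<le> real j / real N"
      unfolding ts using b N by (intro mult_left_le) auto
    moreover have "v j * (t - s) \<le> 1 * (t - s)"
      using IH tj calculation by (intro mult_right_mono) auto
    ultimately show ?thesis using IH by auto
  qed
  have 2: "t * (t ^ j - v j) \<le> t ^ j - v j" "0 \<le> t * (t ^ j - v j)"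
    using t IH by (auto intro: mult_left_le_one_le)
  \<comment> \<open>The new error is the old one shrunk by t plus the error of the last factor, and
    the increments j/N add up to j (j - 1) / (2 N).\<close>
  have "t ^ Suc j - v (Suc j) = t * (t ^ j - v j) + v j * (t - s)"
    by (simp add: v algebra_simps)
  moreover have "real j * (real j - 1) / (2 * real N) + real j / real N
      = real (Suc j) * (real (Suc j) - 1) / (2 * real N)"
    using N by (simp add: field_simps)
  ultimately show ?case
    using 1 2 IH unfolding t_def[symmetric] v by linarith
qed

definition bernstein_coeff :: "real poly poly \<Rightarrow> nat \<Rightarrow> nat \<Rightarrow> real poly"
  where "bernstein_coeff f N k =
    (\<Sum>i\<le>deg_Y f. \<Sum>j\<le>deg_X f.
      monom (real (bernstein_weight N j k) * coeff (coeff f i) j) i)"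

lemma degree_coeff_le_deg_X: "i \<le> deg_Y f \<Longrightarrow> degree (coeff f i) \<le> deg_X f"
  unfolding deg_X_def deg_Y_def by (intro Max_ge) auto

lemma poly_poly_eq_sum_monom:
  "f = (\<Sum>i\<le>deg_Y f. \<Sum>j\<le>deg_X f. monom (monom (coeff (coeff f i) j) j) i)"
proof -
  have "f = (\<Sum>i\<le>deg_Y f. monom (coeff f i) i)"
    by (simp add: deg_Y_def poly_as_sum_of_monoms)
  also have "\<dots> = (\<Sum>i\<le>deg_Y f. monom (\<Sum>j\<le>deg_X f. monom (coeff (coeff f i) j) j) i)"
    by (intro sum.cong refl) (simp add: poly_as_sum_of_monoms' degree_coeff_le_deg_X)
  finally show ?thesis by (simp add: monom_sum)
qed

lemma var_X_power: "var_X ^ j = [:monom 1 j:]"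
  by (induction j) (auto simp: monom_0 monom_Suc one_pCons)

text \<open>Separates the Y-part from the power of X, so that
  \<open>power_bernstein_expansion\<close> can be applied to the latter alone.\<close>

lemma monom_monom_eq: "monom (monom a j) i = poly_in_Y (monom a i) * var_X ^ j"
  unfolding var_X_power
  by (rule poly_eqI) (simp add: coeff_monom smult_monom mult.commute[of _ "[:_:]"])

lemma poly_in_Y_monom_of_nat_mult:
  "poly_in_Y (monom (real n * a) i) = of_nat n * poly_in_Y (monom a i)"
  by (rule poly_eqI) (simp add: of_nat_poly)

lemma bernstein_expansion:
  assumes "deg_X f \<le> N"
  shows "f = (\<Sum>k\<le>N. poly_in_Y (bernstein_coeff f N k) * var_X ^ k * (1 - var_X) ^ (N - k))"
proof -
  let ?a = "\<lambda>i j. poly_in_Y (monom (coeff (coeff f i) j) i)"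
  let ?b = "\<lambda>k. var_X ^ k * (1 - var_X) ^ (N - k)"
  let ?w = "\<lambda>j k. of_nat (bernstein_weight N j k)"
  have "f = (\<Sum>i\<le>deg_Y f. \<Sum>j\<le>deg_X f. ?a i j * var_X ^ j)"
    by (subst poly_poly_eq_sum_monom) (simp only: monom_monom_eq)
  also have "\<dots> = (\<Sum>i\<le>deg_Y f. \<Sum>j\<le>deg_X f. ?a i j * (\<Sum>k\<le>N. ?w j k * var_X ^ k * (1 - var_X) ^ (N - k)))"
    using assms
    by (intro sum.cong refl arg_cong[where f = "\<lambda>z. _ * z"] power_bernstein_expansion) auto
  also have "\<dots> = (\<Sum>i\<le>deg_Y f. \<Sum>j\<le>deg_X f. \<Sum>k\<le>N. ?w j k * ?a i j * ?b k)"
    by (simp only: sum_distrib_left mult_ac)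
  also have "\<dots> = (\<Sum>i\<le>deg_Y f. \<Sum>k\<le>N. \<Sum>j\<le>deg_X f. ?w j k * ?a i j * ?b k)"
    by (rule sum.cong[OF refl]) (rule sum.swap)
  also have "\<dots> = (\<Sum>k\<le>N. \<Sum>i\<le>deg_Y f. \<Sum>j\<le>deg_X f. ?w j k * ?a i j * ?b k)"
    by (rule sum.swap)
  also have "\<dots> = (\<Sum>k\<le>N. poly_in_Y (bernstein_coeff f N k) * ?b k)"
    by (simp only: bernstein_coeff_def poly_in_Y_sum poly_in_Y_monom_of_nat_mult sum_distrib_right)
  finally show ?thesis by (simp only: mult.assoc)
qed

lemma degree_bernstein_coeff_le: "degree (bernstein_coeff f N k) \<le> deg_Y f"
  unfolding bernstein_coeff_def
  by (intro degree_sum_le finite_atMost) (auto intro: order_trans[OF degree_monom_le])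

section \<open>Positivity on the cylinder\<close>

lemma abs_coeff_le_norm_inf:
  assumes "i \<le> deg_Y f" "j \<le> deg_X f"
  shows "\<bar>coeff (coeff f i) j\<bar> \<le> norm_inf f"
proof -
  have "{\<bar>coeff (coeff f i) j\<bar> | i j. i \<le> deg_Y f \<and> j \<le> deg_X f}
      = (\<lambda>(i, j). \<bar>coeff (coeff f i) j\<bar>) ` ({..deg_Y f} \<times> {..deg_X f})"
    by auto
  then show ?thesis unfolding norm_inf_def using assms by (intro Max_ge) auto
qed

text \<open>At the point (0, 0, 1) of the cylinder the homogenisation takes the constant coefficient
  of f as its value.\<close>

lemma f_bullet_le_norm_inf: "f_bullet f \<le> norm_inf f"
proof -
  have "eval3 (homog_Y f) 0 0 1 \<in> cylinder_values f"
    unfolding cylinder_values_def by force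
  then have "f_bullet f \<le> eval3 (homog_Y f) 0 0 1" by (rule f_bullet_le)
  also have "\<dots> = coeff (coeff f 0) 0"
  proof -
    have "(\<Sum>j\<le>deg_X f. coeff (coeff f i) j * 0 ^ j * 0 ^ i * 1 ^ (deg_Y f - i))
        = (if i = 0 then coeff (coeff f 0) 0 else 0)" for i
      by (simp add: power_0_left if_distrib[of "\<lambda>x. _ * x"] cong: if_cong)
    then show ?thesis by (simp add: eval3_homog_Y)
  qed
  also have "\<dots> \<le> norm_inf f" using abs_coeff_le_norm_inf[of 0 f 0] by simp
  finally show ?thesis .
qed

section \<open>Positivity of the minimum\<close>

lemma positive_poly_lead_coeff:
  fixes p :: "real poly"
  assumes "\<And>x. poly p x > 0"
  shows "lead_coeff p > 0"
proof (rule ccontr)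
  assume "\<not> lead_coeff p > 0"
  moreover have "p \<noteq> 0" using assms[of 0] by auto
  ultimately have "lead_coeff (- p) > 0" by (simp add: leading_coeff_neq_0 less_le not_less)
  then obtain n where "\<And>x. x \<ge> n \<Longrightarrow> poly (- p) x \<ge> lead_coeff (- p)"
    using poly_pinfty_gt_lc by blast
  from this[of n] assms[of n] \<open>lead_coeff (- p) > 0\<close> show False by simp
qed

text \<open>Both p(Y) and p(-Y) are positive, so both leading coefficients are, and they differ by
  (-1)^(degree p).\<close>

lemma positive_poly_even_degree:
  fixes p :: "real poly"
  assumes "\<And>x. poly p x > 0"
  shows "even (degree p)"
proof -
  have "lead_coeff (pcompose p [:0, -1:]) > 0"
    using assms by (intro positive_poly_lead_coeff) (simp add: poly_pcompose)
  then have "lead_coeff p * (-1) ^ degree p > 0" by (simp add: lead_coeff_comp)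
  with positive_poly_lead_coeff[OF assms] show ?thesis
    by (auto simp: zero_less_mult_iff zero_less_power_eq)
qed

lemma coeff_spec_X [simp]: "coeff (spec_X f x) i = poly (coeff f i) x"
  by (simp add: spec_X_def coeff_map_poly)

lemma poly_spec_X: "poly (spec_X f x) y = eval2 f x y"
proof -
  have "degree (spec_X f x) \<le> degree f"
    unfolding spec_X_def by (rule map_poly_degree_leq)
  then have "poly (spec_X f x) y = poly (\<Sum>i\<le>degree f. monom (poly (coeff f i) x) i) y"
    using poly_as_sum_of_monoms'[of "spec_X f x" "degree f"] by simp
  also have "\<dots> = eval2 f x y"
    by (simp add: eval2_def poly_altdef[of f] poly_sum poly_monom)
  finally show ?thesis .
qed

lemma eval3_homog_Y_spec:
  "eval3 (homog_Y f) x y z = (\<Sum>i\<le>deg_Y f. coeff (spec_X f x) i * y ^ i * z ^ (deg_Y f - i))"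
proof -
  have "poly (coeff f i) x = (\<Sum>j\<le>deg_X f. coeff (coeff f i) j * x ^ j)" if "i \<le> deg_Y f" for i
    using arg_cong[OF poly_as_sum_of_monoms'[OF degree_coeff_le_deg_X[OF that]],
        of "\<lambda>p. poly p x"]
    by (simp add: poly_sum poly_monom)
  then show ?thesis unfolding eval3_homog_Y by (simp add: sum_distrib_right)
qed

text \<open>At a minimising point with z nonzero the value is z^m f(x, y/z). With z = 0 it is y^m
  times the leading coefficient of f(x, Y), which has degree exactly m since f is fully m-ic. As m
  is even, both are positive.\<close>

lemma f_bullet_pos:
  assumes pos: "\<forall>x\<in>{0..1}. \<forall>y. eval2 f x y > 0" and mic: "fully_mic (deg_Y f) f"
  shows "f_bullet f > 0"
proof -
  define m where "m = deg_Y f"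
  obtain x y z where x: "x \<in> {0..1}" and yz: "y\<^sup>2 + z\<^sup>2 = 1"
    and v: "f_bullet f = eval3 (homog_Y f) x y z"
    using f_bullet_in[of f] unfolding cylinder_values_def by auto
  define p where "p = spec_X f x"
  have p: "\<And>y. poly p y > 0" using pos x by (simp add: p_def poly_spec_X)
  have m: "degree p = m" using mic x by (simp add: fully_mic_def p_def m_def)
  have ev: "even m" using positive_poly_even_degree[of p] p m by simp
  have val: "f_bullet f = (\<Sum>i\<le>m. coeff p i * y ^ i * z ^ (m - i))"
    unfolding v eval3_homog_Y_spec p_def m_def ..
  show ?thesis
  proof (cases "z = 0")
    case True
    then have "y \<noteq> 0" using yz by auto
    have "f_bullet f = (\<Sum>i\<le>m. if i = m then coeff p i * y ^ i else 0)"
      unfolding val by (intro sum.cong refl) (auto simp: True power_0_left)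
    also have "\<dots> = coeff p m * y ^ m" by simp
    also have "\<dots> > 0"
      using positive_poly_lead_coeff[of p] p m \<open>y \<noteq> 0\<close> ev by (simp add: zero_less_power_eq)
    finally show ?thesis .
  next
    case False
    have "f_bullet f = (\<Sum>i\<le>m. z ^ m * (coeff p i * (y / z) ^ i))"
      unfolding val
    proof (intro sum.cong refl)
      fix i assume "i \<in> {..m}"
      then have "z ^ m = z ^ i * z ^ (m - i)" by (simp flip: power_add)
      then show "coeff p i * y ^ i * z ^ (m - i) = z ^ m * (coeff p i * (y / z) ^ i)"
        using False by (simp add: power_divide)
    qed
    also have "\<dots> = z ^ m * poly p (y / z)"
      by (simp add: poly_altdef m sum_distrib_left)
    also have "\<dots> > 0" using p False ev by (simp add: zero_less_power_eq)
    finally show ?thesis .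
  qed
qed

text \<open>Summing the collision bounds over all powers of X produces the constant 6.\<close>

lemma sum_collision_bound:
  "(\<Sum>j\<le>d. real j * (real j - 1) / (2 * c)) = (real d ^ 3 - real d) / (6 * c)"
proof (induction d)
  case (Suc d)
  have "real (Suc d) * (real (Suc d) - 1) / (2 * c) + (real d ^ 3 - real d) / (6 * c)
      = (real (Suc d) ^ 3 - real (Suc d)) / (6 * c)"
    by (cases "c = 0") (simp_all add: field_simps power3_eq_cube)
  with Suc show ?case by simp
qed simp

lemma bernstein_coeff_nonneg:
  assumes fb: "f_bullet f > 0" and N: "N > 0" "deg_X f \<le> N" "k \<le> N"
    and large: "real (deg_X f) ^ 3 * (real (deg_Y f) + 1) * norm_inf f \<le> 6 * real N * f_bullet f"
  shows "poly (bernstein_coeff f N k) y \<ge> 0"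
proof -
  define m d where "m = deg_Y f" and "d = deg_X f"
  define a where "a = (\<lambda>i j. coeff (coeff f i) j)"
  define t where "t = real k / real N"
  define v where "v = (\<lambda>j. \<Prod>i<j. (real k - real i) / (real N - real i))"
  \<comment> \<open>Dividing by r moves (y, 1) to the unit circle; homogeneity of degree m in (Y, Z)
    then gives f(t, y) >= r^m \<open>f_bullet f\<close>.\<close>
  define r where "r = sqrt (1 + y\<^sup>2)"
  have r: "r > 0" "r\<^sup>2 = 1 + y\<^sup>2" by (simp_all add: r_def add_pos_nonneg)
  have r1: "r \<ge> 1" "\<bar>y\<bar> \<le> r" by (auto simp: r_def intro!: real_le_rsqrt)
  have t: "t \<in> {0..1}" using N by (simp add: t_def)
  have "eval3 (homog_Y f) t (y / r) (1 / r) \<in> cylinder_values f"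
    unfolding cylinder_values_def using t r
    by (intro CollectI exI conjI refl)
       (auto simp: power_divide add.commute simp flip: add_divide_distrib)
  then have "r ^ m * f_bullet f \<le> r ^ m * eval3 (homog_Y f) t (y / r) (1 / r)"
    using r by (intro mult_left_mono f_bullet_le) auto
  also have "\<dots> = (\<Sum>i\<le>m. \<Sum>j\<le>d. a i j * t ^ j * y ^ i)"
    unfolding eval3_homog_Y sum_distrib_left m_def[symmetric] d_def[symmetric]
  proof (intro sum.cong refl)
    fix i j assume "i \<in> {..m}"
    then have "r ^ m = r ^ i * r ^ (m - i)" by (simp flip: power_add)
    then show "r ^ m * (coeff (coeff f i) j * t ^ j * (y / r) ^ i * (1 / r) ^ (m - i))
        = a i j * t ^ j * y ^ i"
      using r by (simp add: a_def power_divide)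
  qed
  finally have 1: "r ^ m * f_bullet f \<le> (\<Sum>i\<le>m. \<Sum>j\<le>d. a i j * t ^ j * y ^ i)" .
  have "(\<Sum>i\<le>m. \<Sum>j\<le>d. a i j * t ^ j * y ^ i) - (\<Sum>i\<le>m. \<Sum>j\<le>d. a i j * v j * y ^ i)
      = (\<Sum>i\<le>m. \<Sum>j\<le>d. a i j * (t ^ j - v j) * y ^ i)"
    by (simp add: sum_subtractf algebra_simps)
  also have "\<dots> \<le> (\<Sum>i\<le>m. \<Sum>j\<le>d. norm_inf f * (real j * (real j - 1) / (2 * real N)) * r ^ m)"
  proof (intro sum_mono)
    fix i j assume ij: "i \<in> {..m}" "j \<in> {..d}"
    have "\<bar>a i j\<bar> \<le> norm_inf f"
      using ij abs_coeff_le_norm_inf unfolding a_def m_def d_def by auto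
    moreover have "\<bar>t ^ j - v j\<bar> \<le> real j * (real j - 1) / (2 * real N)"
      using falling_quotient_bounds[of j N k] ij N unfolding v_def t_def d_def by auto
    \<comment> \<open>The error thus scales with the same r^m as the lower bound, which makes the
      comparison uniform in y.\<close>
    moreover have "\<bar>y\<bar> ^ i \<le> r ^ m"
      using power_mono[OF r1(2), of i] power_increasing[OF _ r1(1), of i m] ij by auto
    moreover have "0 \<le> norm_inf f" "0 \<le> real j * (real j - 1) / (2 * real N)"
      using calculation(1,2) by linarith+
    ultimately have "\<bar>a i j\<bar> * \<bar>t ^ j - v j\<bar> * \<bar>y\<bar> ^ i
        \<le> norm_inf f * (real j * (real j - 1) / (2 * real N)) * r ^ m"
      by (intro mult_mono mult_nonneg_nonneg abs_ge_zero zero_le_power) assumption+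
    moreover have "a i j * (t ^ j - v j) * y ^ i \<le> \<bar>a i j\<bar> * \<bar>t ^ j - v j\<bar> * \<bar>y\<bar> ^ i"
      using abs_ge_self[of "a i j * (t ^ j - v j) * y ^ i"] by (simp add: abs_mult power_abs)
    ultimately show "a i j * (t ^ j - v j) * y ^ i
        \<le> norm_inf f * (real j * (real j - 1) / (2 * real N)) * r ^ m"
      by linarith
  qed
  also have "\<dots> = r ^ m * ((real m + 1) * norm_inf f * ((real d ^ 3 - real d) / (6 * real N)))"
    unfolding sum_distrib_right[symmetric] sum_distrib_left[symmetric] sum_collision_bound
    by (simp add: algebra_simps)
  also have "\<dots> \<le> r ^ m * f_bullet f"
  proof (intro mult_left_mono)
    have "(real m + 1) * norm_inf f * (real d ^ 3 - real d) \<le> (real m + 1) * norm_inf f * real d ^ 3"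
      using fb f_bullet_le_norm_inf[of f] by (intro mult_left_mono) auto
    also have "\<dots> \<le> 6 * real N * f_bullet f"
      using large by (simp add: m_def d_def mult_ac)
    finally show "(real m + 1) * norm_inf f * ((real d ^ 3 - real d) / (6 * real N)) \<le> f_bullet f"
      using N by (simp add: field_simps)
  qed (use r in auto)
  finally have "0 \<le> (\<Sum>i\<le>m. \<Sum>j\<le>d. a i j * v j * y ^ i)" using 1 by linarith
  \<comment> \<open>The binomial factor turns each v j back into a Bernstein weight.\<close>
  then have "0 \<le> real (N choose k) * (\<Sum>i\<le>m. \<Sum>j\<le>d. a i j * v j * y ^ i)" by simp
  also have "\<dots> = (\<Sum>i\<le>m. \<Sum>j\<le>d. real (bernstein_weight N j k) * a i j * y ^ i)"
    unfolding sum_distrib_left using N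
    by (intro sum.cong refl) (simp add: bernstein_weight_eq_prod v_def d_def)
  also have "\<dots> = poly (bernstein_coeff f N k) y"
    by (simp add: bernstein_coeff_def poly_sum poly_monom a_def m_def d_def)
  finally show ?thesis .
qed

section \<open>Splitting by parity and the degree bounds\<close>

lemma even_powers_eq_square:
  fixes x y :: "'a::comm_semiring_1"
  shows "b * x ^ (2 * l) * y ^ (2 * n) = b * (x ^ l * y ^ n)\<^sup>2"
  by (simp add: power_mult_distrib power_mult[symmetric] mult.commute[of 2] mult.assoc)

lemma odd_powers_eq_square_mult:
  fixes x y :: "'a::comm_semiring_1"
  shows "b * (x ^ l * y ^ n)\<^sup>2 * x * y = b * x ^ (2 * l + 1) * y ^ (2 * n + 1)"
  by (simp add: even_powers_eq_square[symmetric] mult_ac)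

theorem theorem4:
  fixes f :: "real poly poly" and m d :: nat
  assumes "\<forall>x\<in>{0..1}. \<forall>y. eval2 f x y > 0"
    and "m = deg_Y f"
    and "fully_mic m f"
    and "d = deg_X f"
    and "d \<ge> 2"
  shows "f_bullet f > 0 \<and>
    (\<exists>\<sigma>0 \<in> sums_of_squares. \<exists>\<sigma>1 \<in> sums_of_squares.
       f = \<sigma>0 + \<sigma>1 * var_X * (1 - var_X) \<and>
       real (total_deg \<sigma>0) \<le> real d ^ 3 * (real m + 1) * norm_inf f / f_bullet f \<and>
       real (total_deg (\<sigma>1 * var_X * (1 - var_X)))
         \<le> real d ^ 3 * (real m + 1) * norm_inf f / f_bullet f)"
proof -
  have fb: "f_bullet f > 0" using f_bullet_pos assms by simp
  define Q where "Q = real d ^ 3 * (real m + 1) * norm_inf f / f_bullet f"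
  have d3: "4 * real d \<le> real d ^ 3"
    using mult_mono[of 2 "real d" 2 "real d"] mult_right_mono[of 4 "real d * real d" "real d"] assms(5)
    by (simp add: power3_eq_cube)
  have "real d ^ 3 * (real m + 1) * 1 \<le> real d ^ 3 * (real m + 1) * (norm_inf f / f_bullet f)"
    using fb f_bullet_le_norm_inf[of f] by (intro mult_left_mono) auto
  then have Q_ge: "real d ^ 3 * (real m + 1) \<le> Q" by (simp add: Q_def)
  have Q_ge_d: "4 * real d \<le> Q"
    using d3 mult_left_mono[of 1 "real m + 1" "real d ^ 3"] Q_ge by simp
  have Q_ge_m: "8 * (real m + 1) \<le> Q"
    using mult_right_mono[of 8 "real d ^ 3" "real m + 1"] d3 Q_ge assms(5) by simp
  \<comment> \<open>This gives Q/4 <= N <= Q/4 + 2. Hence d <= N from 4 d <= Q, and Q <= 6 N. From 8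
    (m + 1) <= Q it follows that m + N <= 3 Q/8 + 1 <= Q.\<close>
  define M where "M = nat \<lceil>Q / 8\<rceil>"
  define N where "N = 2 * M"
  have M: "Q / 8 \<le> real M" "real M \<le> Q / 8 + 1"
    using Q_ge_m of_int_ceiling_le_add_one[of "Q / 8"] by (simp_all add: M_def)
  have N: "N > 0" "d \<le> N" "Q \<le> 6 * real N" "real (m + N) \<le> Q"
    using M Q_ge_m Q_ge_d assms(5) unfolding N_def by auto
  define B where "B = (\<lambda>k. poly_in_Y (bernstein_coeff f N k))"
  define T where "T = (\<lambda>k. B k * var_X ^ k * (1 - var_X) ^ (N - k))"
  have B: "B k \<in> sums_of_squares" if "k \<le> N" for k
    unfolding B_def using N that fb assms
    by (intro poly_in_Y_sums_of_squares nonneg_poly_sums_of_squares bernstein_coeff_nonneg)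
       (auto simp: Q_def field_simps)
  have f: "f = sum T {..N}"
    unfolding T_def B_def using N assms by (intro bernstein_expansion) auto
  have degT: "total_deg (T k) \<le> m + N" if "k \<le> N" for k
    using total_deg_bernstein_term_le[OF that, of "bernstein_coeff f N k"]
      degree_bernstein_coeff_le[of f N k] assms(2) unfolding T_def B_def by linarith
  define \<sigma>0 where "\<sigma>0 = (\<Sum>k | k \<le> N \<and> even k. T k)"
  define \<sigma>1 where "\<sigma>1 = (\<Sum>k | k \<le> N \<and> odd k.
    B k * (var_X ^ (k div 2) * (1 - var_X) ^ ((N - k) div 2))\<^sup>2)"
  have \<sigma>1: "\<sigma>1 * var_X * (1 - var_X) = (\<Sum>k | k \<le> N \<and> odd k. T k)"
    unfolding \<sigma>1_def sum_distrib_right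
  proof (intro sum.cong refl)
    fix k assume "k \<in> {k. k \<le> N \<and> odd k}"
    \<comment> \<open>As N is even, N - k is odd along with k, so one factor X and one factor 1 - X
      split off; l < M keeps M - l - 1 from truncating.\<close>
    then obtain l where k: "k = 2 * l + 1" "l < M"
      by (auto simp: N_def elim!: oddE)
    then have Nk: "N - k = 2 * (M - l - 1) + 1" by (auto simp: N_def)
    have div2: "k div 2 = l" "(N - k) div 2 = M - l - 1"
      unfolding Nk by (simp_all add: k(1))
    show "B k * (var_X ^ (k div 2) * (1 - var_X) ^ ((N - k) div 2))\<^sup>2 * var_X * (1 - var_X) = T k"
      unfolding T_def div2 unfolding Nk unfolding k(1) by (rule odd_powers_eq_square_mult)
  qed
  have "\<sigma>0 \<in> sums_of_squares"
    unfolding \<sigma>0_def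
  proof (rule sums_of_squares_sum)
    fix k assume "k \<in> {k. k \<le> N \<and> even k}"
    then obtain l where k: "k = 2 * l" "l \<le> M" "k \<le> N" by (auto simp: N_def elim!: evenE)
    have "N - k = 2 * (M - l)" by (simp add: N_def k(1))
    then have "T k = B k * (var_X ^ l * (1 - var_X) ^ (M - l))\<^sup>2"
      unfolding T_def by (simp only: k(1) even_powers_eq_square)
    then show "T k \<in> sums_of_squares" by (simp only: sums_of_squares_mult_square B[OF k(3)])
  qed
  moreover have "\<sigma>1 \<in> sums_of_squares"
    unfolding \<sigma>1_def by (intro sums_of_squares_sum sums_of_squares_mult_square B) auto
  moreover have "f = \<sigma>0 + \<sigma>1 * var_X * (1 - var_X)"
  proof -
    have "sum T {..N} = sum T ({k. k \<le> N \<and> even k} \<union> {k. k \<le> N \<and> odd k})"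
      by (rule sum.cong) auto
    also have "\<dots> = \<sigma>0 + \<sigma>1 * var_X * (1 - var_X)"
      unfolding \<sigma>1 unfolding \<sigma>0_def by (rule sum.union_disjoint) auto
    finally show ?thesis using f by (rule trans[rotated])
  qed
  moreover have "total_deg \<sigma>0 \<le> m + N"
    unfolding \<sigma>0_def by (intro total_deg_sum_le degT) auto
  then have "real (total_deg \<sigma>0) \<le> Q" using N(4) by linarith
  moreover have "total_deg (\<sigma>1 * var_X * (1 - var_X)) \<le> m + N"
    unfolding \<sigma>1 by (intro total_deg_sum_le degT) auto
  then have "real (total_deg (\<sigma>1 * var_X * (1 - var_X))) \<le> Q" using N(4) by linarith
  ultimately show ?thesis
    using fb unfolding Q_def by blast
qed

end
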